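(* Let $A_0$ and $A_1$ be NFAs over an alphabet $\Sigma$ of cardinality $m$, each of depth at most $n$. Assume that there is no infinite tower between the languages $L(A_0)$ and $L(A_1)$. Let $(w_i)_{i=1}^r$ be a tower between $L(A_0)$ and $L(A_1)$ such that $w_i\in L(A_{i \bmod 2})$ for every $i$. Then $r \le \frac{n^{m+1}-1}{n-1}$.
   Context: All automata are assumed to have no useless states (every state lies on an accepting path). A path in an NFA is simple if its states are pairwise distinct; the depth of an NFA is the number of states on its longest simple path. For strings $v=a_1\cdots a_k$ and $w$, $v\preccurlyeq w$ ($v$ is a subsequence of $w$) if $w\in\Sigma^*a_1\Sigma^*a_2\Sigma^*\cdots\Sigma^*a_k\Sigma^*$. A sequence $(w_i)_{i=1}^r$ of strings is a tower between languages $K$ and $L$ if $w_1\in K\cup L$ and for all $i=1,\dots,r-1$: $w_i\preccurlyeq w_{i+1}$, $w_i\in K$ implies $w_{i+1}\in L$, and $w_i\in L$ implies $w_{i+1}\in K$; $r$ is its height. An infinite tower is an infinite sequence with the same properties. *)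

theory Defs
  imports Complex_Main "HOL-Library.Sublist"
begin

record ('q, 'a) nfa =
  states :: "'q set"
  init   :: "'q set"
  final  :: "'q set"
  trans  :: "('q \<times> 'a \<times> 'q) set"

definition nfa_over :: "'a set \<Rightarrow> ('q, 'a) nfa \<Rightarrow> bool" where
  "nfa_over Sig A \<longleftrightarrow> finite (states A) \<and> init A \<subseteq> states A \<and> final A \<subseteq> states A
     \<and> trans A \<subseteq> states A \<times> Sig \<times> states A"

definition is_run :: "('q, 'a) nfa \<Rightarrow> 'q list \<Rightarrow> 'a list \<Rightarrow> bool" where
  "is_run A qs w \<longleftrightarrow> length qs = Suc (length w) \<and> set qs \<subseteq> states A \<and>
     (\<forall>i < length w. (qs ! i, w ! i, qs ! Suc i) \<in> trans A)"

definition accepting_run :: "('q, 'a) nfa \<Rightarrow> 'q list \<Rightarrow> 'a list \<Rightarrow> bool" where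
  "accepting_run A qs w \<longleftrightarrow> is_run A qs w \<and> hd qs \<in> init A \<and> last qs \<in> final A"

definition lang :: "('q, 'a) nfa \<Rightarrow> 'a list set" where
  "lang A = {w. \<exists>qs. accepting_run A qs w}"

definition no_useless_states :: "('q, 'a) nfa \<Rightarrow> bool" where
  "no_useless_states A \<longleftrightarrow> (\<forall>q \<in> states A. \<exists>qs w. accepting_run A qs w \<and> q \<in> set qs)"

definition simple_path :: "('q, 'a) nfa \<Rightarrow> 'q list \<Rightarrow> bool" where
  "simple_path A qs \<longleftrightarrow> qs \<noteq> [] \<and> set qs \<subseteq> states A \<and> distinct qs \<and>
     (\<forall>i. Suc i < length qs \<longrightarrow> (\<exists>a. (qs ! i, a, qs ! Suc i) \<in> trans A))"

definition depth :: "('q, 'a) nfa \<Rightarrow> nat" where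
  "depth A = Max (insert 0 {length qs | qs. simple_path A qs})"

definition tower :: "'a list set \<Rightarrow> 'a list set \<Rightarrow> (nat \<Rightarrow> 'a list) \<Rightarrow> nat \<Rightarrow> bool" where
  "tower K L w r \<longleftrightarrow> 1 \<le> r \<and> w 1 \<in> K \<union> L \<and>
     (\<forall>i. 1 \<le> i \<and> i < r \<longrightarrow> subseq (w i) (w (Suc i)) \<and>
        (w i \<in> K \<longrightarrow> w (Suc i) \<in> L) \<and> (w i \<in> L \<longrightarrow> w (Suc i) \<in> K))"

definition infinite_tower :: "'a list set \<Rightarrow> 'a list set \<Rightarrow> (nat \<Rightarrow> 'a list) \<Rightarrow> bool" where
  "infinite_tower K L w \<longleftrightarrow> w 1 \<in> K \<union> L \<and>
     (\<forall>i. 1 \<le> i \<longrightarrow> subseq (w i) (w (Suc i)) \<and>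
        (w i \<in> K \<longrightarrow> w (Suc i) \<in> L) \<and> (w i \<in> L \<longrightarrow> w (Suc i) \<in> K))"

end

theory Submission
  imports Defs
begin

text \<open>
  Call a sequence of letters \<open>a\<close> and blocks \<open>\<Gamma>\<^sup>*\<close> a pattern, and call a language cofinal in a
  pattern if every word of the pattern is a subsequence of a word of the pattern lying in the
  language.  If both languages were cofinal in one pattern, alternating between them would give an
  infinite tower.  We walk down the tower from \<open>w\<^sub>r\<close>, keeping a pattern that contains \<open>w\<^sub>i\<close> and in
  which \<open>L(A\<^sub>i)\<close> is cofinal.  The word \<open>w\<^sub>i\<close> splits along the pattern of \<open>w\<^sub>i\<^sub>+\<^sub>1\<close>; a block \<open>\<Gamma>\<^sup>*\<close> survives
  if the corresponding part of the run can be routed through a cycle whose set of labels is \<open>\<Gamma>\<close>.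
  Otherwise cutting out maximal cycles replaces it by at most \<open>n\<close> blocks over proper subsets of \<open>\<Gamma>\<close>
  and at most \<open>n - 1\<close> letters.  Consecutive patterns differ, so giving letters weight \<open>1\<close> and blocks
  \<open>\<Gamma>\<^sup>*\<close> weight \<open>n + n\<^sup>2 + \<dots> + n\<^bsup>|\<Gamma>|\<^esup>\<close> makes the weight drop at every step.
\<close>

section \<open>Patterns\<close>

datatype 'a piece = Letter 'a | Block "'a set"

fun piece_lang :: "'a piece \<Rightarrow> 'a list set" where
  "piece_lang (Letter a) = {[a]}"
| "piece_lang (Block G) = lists G"

fun pattern_lang :: "'a piece list \<Rightarrow> 'a list set" where
  "pattern_lang [] = {[]}"
| "pattern_lang (b # P) = {u @ v | u v. u \<in> piece_lang b \<and> v \<in> pattern_lang P}"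

fun finite_piece :: "'a piece \<Rightarrow> bool" where
  "finite_piece (Letter a) = True"
| "finite_piece (Block G) = finite G"

definition block_weight :: "nat \<Rightarrow> nat \<Rightarrow> nat" where
  "block_weight n j = (\<Sum>i=1..j. n ^ i)"

fun piece_weight :: "nat \<Rightarrow> 'a piece \<Rightarrow> nat" where
  "piece_weight n (Letter a) = 1"
| "piece_weight n (Block G) = block_weight n (card G)"

definition weight :: "nat \<Rightarrow> 'a piece list \<Rightarrow> nat" where
  "weight n P = sum_list (map (piece_weight n) P)"

text \<open>The witness has to lie in the pattern again, so that two languages cofinal in the same
  pattern can extend each other's words in turn.\<close>

definition cofinal_in :: "'a list set \<Rightarrow> 'a piece list \<Rightarrow> bool" where
  "cofinal_in L P \<longleftrightarrow> (\<forall>u \<in> pattern_lang P. \<exists>u' \<in> pattern_lang P \<inter> L. subseq u u')"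

lemma weight_simps [simp]:
  "weight n [] = 0" "weight n (b # P) = piece_weight n b + weight n P"
  "weight n (P @ Q) = weight n P + weight n Q"
  by (simp_all add: weight_def)

text \<open>The weight is made for this recursion: for positive \<open>n\<close>, \<open>n\<close>
  blocks of weight \<open>block_weight n j\<close> with \<open>n - 1\<close> letters between them
  weigh one less than a block over \<open>Suc j\<close> letters.\<close>

lemma block_weight_Suc: "block_weight n (Suc j) = n * block_weight n j + n"
proof (induction j)
  case 0
  show ?case by (simp add: block_weight_def)
next
  case (Suc j)
  have step: "block_weight n (Suc i) = block_weight n i + n ^ Suc i" for i
    by (simp add: block_weight_def)
  have "n * block_weight n (Suc j) = n * block_weight n j + n ^ Suc (Suc j)"
    by (simp add: step distrib_left)
  then show ?case
    using Suc.IH step[of "Suc j"] by linarith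
qed

lemma block_weight_mono: "i \<le> j \<Longrightarrow> block_weight n i \<le> block_weight n j"
  unfolding block_weight_def by (rule sum_mono2) auto

lemma pattern_lang_append:
  "pattern_lang (P @ Q) = {u @ v | u v. u \<in> pattern_lang P \<and> v \<in> pattern_lang Q}"
proof (induction P)
  case Nil
  show ?case by simp
next
  case (Cons b P)
  have "pattern_lang ((b # P) @ Q) = {x @ u @ v | x u v.
      x \<in> piece_lang b \<and> u \<in> pattern_lang P \<and> v \<in> pattern_lang Q}"
    using Cons.IH by (simp, blast)
  also have "\<dots> = {y @ v | y v. y \<in> pattern_lang (b # P) \<and> v \<in> pattern_lang Q}"
    by (simp, metis (no_types, opaque_lifting) append.assoc)
  finally show ?case .
qed

lemma pattern_lang_appendI:
  "u \<in> pattern_lang P \<Longrightarrow> v \<in> pattern_lang Q \<Longrightarrow> u @ v \<in> pattern_lang (P @ Q)"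
  by (auto simp: pattern_lang_append)

lemma pattern_lang_single [simp]: "pattern_lang [b] = piece_lang b"
  by auto

lemma cofinal_in_mono: "cofinal_in L P \<Longrightarrow> L \<subseteq> L' \<Longrightarrow> cofinal_in L' P"
  unfolding cofinal_in_def by blast

lemma cofinal_in_append:
  assumes "cofinal_in L P" "cofinal_in L' Q"
  shows "cofinal_in {u @ v | u v. u \<in> L \<and> v \<in> L'} (P @ Q)"
  unfolding cofinal_in_def
proof
  fix w assume "w \<in> pattern_lang (P @ Q)"
  then obtain u v where w: "w = u @ v" and uv: "u \<in> pattern_lang P" "v \<in> pattern_lang Q"
    by (auto simp: pattern_lang_append)
  obtain u' where u': "u' \<in> pattern_lang P" "u' \<in> L" "subseq u u'"
    using assms(1) uv unfolding cofinal_in_def by blast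
  obtain v' where v': "v' \<in> pattern_lang Q" "v' \<in> L'" "subseq v v'"
    using assms(2) uv unfolding cofinal_in_def by blast
  have "subseq w (u' @ v')"
    using w u' v' by (simp add: list_emb_append_mono)
  then show "\<exists>w' \<in> pattern_lang (P @ Q) \<inter> {u @ v | u v. u \<in> L \<and> v \<in> L'}. subseq w w'"
    using u' v' pattern_lang_appendI by (intro bexI[of _ "u' @ v'"]) blast+
qed

text \<open>Extending \<open>z\<close> alternately into \<open>K\<close> and into \<open>L\<close>,
  without leaving the pattern, never gets stuck.\<close>

lemma infinite_tower_if_both_cofinal:
  assumes z: "z \<in> pattern_lang P" and cof: "cofinal_in K P" "cofinal_in L P"
  shows "\<exists>v. infinite_tower K L v"
proof (cases "K \<inter> L = {}")
  case False
  then obtain x where "x \<in> K" "x \<in> L" by blast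
  then have "infinite_tower K L (\<lambda>_. x)"
    by (simp add: infinite_tower_def)
  then show ?thesis by blast
next
  case True
  define M where "M i = (if even (i::nat) then K else L)" for i
  have "\<forall>i. \<forall>u \<in> pattern_lang P. \<exists>u'. u' \<in> pattern_lang P \<and> u' \<in> M i \<and> subseq u u'"
    using cof unfolding cofinal_in_def M_def by auto
  then obtain f where
    f: "\<And>i u. u \<in> pattern_lang P \<Longrightarrow> f i u \<in> pattern_lang P \<and> f i u \<in> M i \<and> subseq u (f i u)"
    by metis
  define v where "v = rec_nat z f"
  have v_Suc: "v (Suc i) = f i (v i)" for i
    by (simp add: v_def)
  have v_in: "v i \<in> pattern_lang P" for i
    by (induction i) (use z f in \<open>auto simp: v_Suc, simp add: v_def\<close>)
  have v_M: "v (Suc i) \<in> M i" "subseq (v i) (v (Suc i))" for i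
    using f[OF v_in] by (auto simp: v_Suc)
  have "infinite_tower K L v"
    unfolding infinite_tower_def
  proof (intro conjI allI impI)
    \<comment> \<open>The word \<open>z\<close> may lie in neither language; it sits at index 0,
      where a tower has no entry.\<close>
    show "v 1 \<in> K \<union> L"
      using v_M(1)[of 0] by (auto simp: M_def)
  next
    fix i :: nat assume i: "1 \<le> i"
    show "subseq (v i) (v (Suc i))" by (rule v_M)
    obtain j where j: "i = Suc j" using i by (cases i) auto
    \<comment> \<open>By disjointness, the language containing \<open>v i\<close> determines the
      parity of \<open>j\<close>, and the next word lies in the other one.\<close>
    show "v (Suc i) \<in> L" if "v i \<in> K"
      using that True v_M(1)[of j] v_M(1)[of i] by (auto simp: M_def j split: if_splits)
    show "v (Suc i) \<in> K" if "v i \<in> L"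
      using that True v_M(1)[of j] v_M(1)[of i] by (auto simp: M_def j split: if_splits)
  qed
  then show ?thesis by blast
qed

section \<open>Paths\<close>

text \<open>The set \<open>S\<close> confines all states of the path, so that states can be removed
  from it one by one.\<close>

fun path_within :: "('q, 'a) nfa \<Rightarrow> 'q set \<Rightarrow> 'q \<Rightarrow> 'a list \<Rightarrow> 'q \<Rightarrow> bool" where
  "path_within A S p [] q \<longleftrightarrow> p = q \<and> p \<in> S"
| "path_within A S p (a # w) q \<longleftrightarrow>
     p \<in> S \<and> (\<exists>s. (p, a, s) \<in> trans A \<and> path_within A S s w q)"

abbreviation path_words :: "('q, 'a) nfa \<Rightarrow> 'q \<Rightarrow> 'q \<Rightarrow> 'a list set" where
  "path_words A p q \<equiv> {w. path_within A (states A) p w q}"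

lemma path_within_states: "path_within A S p w q \<Longrightarrow> p \<in> S \<and> q \<in> S"
  by (induction w arbitrary: p) auto

lemma path_within_mono: "path_within A S p w q \<Longrightarrow> S \<subseteq> S' \<Longrightarrow> path_within A S' p w q"
  by (induction w arbitrary: p) auto

lemma path_within_append:
  "path_within A S p (u @ v) q \<longleftrightarrow> (\<exists>s. path_within A S p u s \<and> path_within A S s v q)"
  by (induction u arbitrary: p) (auto dest: path_within_states)

lemma is_run_Nil: "is_run A qs [] \<longleftrightarrow> (\<exists>q \<in> states A. qs = [q])"
  by (auto simp: is_run_def length_Suc_conv)

lemma is_run_Cons:
  "is_run A qs (a # w) \<longleftrightarrow>
     (\<exists>q qs'. qs = q # qs' \<and> q \<in> states A \<and> (q, a, hd qs') \<in> trans A \<and> is_run A qs' w)"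
proof (cases qs)
  case Nil
  then show ?thesis by (simp add: is_run_def)
next
  case (Cons q qs')
  then show ?thesis
    by (cases qs') (simp_all add: is_run_def All_less_Suc2 conj_ac del: all_simps)
qed

lemma path_within_iff_run:
  "path_within A (states A) p w q \<longleftrightarrow> (\<exists>qs. is_run A qs w \<and> hd qs = p \<and> last qs = q)"
proof (induction w arbitrary: p)
  case Nil
  then show ?case by (auto simp: is_run_Nil)
next
  case (Cons a w)
  have ne: "is_run A qs w \<Longrightarrow> qs \<noteq> []" for qs by (auto simp: is_run_def)
  show ?case
    unfolding is_run_Cons path_within.simps Cons.IH
  proof safe
    fix qs assume h: "p \<in> states A" "(p, a, hd qs) \<in> trans A" "is_run A qs w"
    then show "\<exists>qsa. (\<exists>q qs'. qsa = q # qs' \<and> q \<in> states A \<and> (q, a, hd qs') \<in> trans A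
        \<and> is_run A qs' w) \<and> hd qsa = p \<and> last qsa = last qs"
      using ne by (intro exI[of _ "p # qs"]) auto
  qed (use ne in auto)
qed

lemma lang_eq_path_words: "lang A = (\<Union>p \<in> init A. \<Union>q \<in> final A. path_words A p q)"
  unfolding lang_def accepting_run_def path_within_iff_run by blast

lemma lang_subset_lists: "nfa_over Sig A \<Longrightarrow> lang A \<subseteq> lists Sig"
proof -
  assume "nfa_over Sig A"
  then have "path_within A (states A) p w q \<Longrightarrow> w \<in> lists Sig" for p q w
    by (induction w arbitrary: p) (auto simp: nfa_over_def)
  then show ?thesis by (auto simp: lang_eq_path_words)
qed

text \<open>If the path after its first step avoids \<open>p\<close>, then only the start
  \<open>t\<close> can be the last visit; otherwise the first letter is put in front of the
  \<open>u\<close> found for the rest.\<close>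

lemma last_visit:
  assumes "path_within A S t w q"
  shows "path_within A (S - {p}) t w q \<or>
    (\<exists>u. path_within A S t u p \<and>
      (w = u \<and> q = p \<or>
       (\<exists>a v s. w = u @ a # v \<and> (p, a, s) \<in> trans A \<and> path_within A (S - {p}) s v q)))"
  using assms
proof (induction w arbitrary: t)
  case Nil
  then show ?case by auto
next
  case (Cons a w)
  then obtain s where s: "t \<in> S" "(t, a, s) \<in> trans A" "path_within A S s w q" by auto
  from Cons.IH[OF s(3)] show ?case
  proof (elim disjE)
    assume avoid: "path_within A (S - {p}) s w q"
    show ?thesis
    proof (cases "t = p")
      case True
      then show ?thesis
        using s avoid by (intro disjI2 exI[of _ "[]"]) auto
    next
      case False
      then show ?thesis using s avoid by auto
    qed
  next
    assume "\<exists>u. path_within A S s u p \<and>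
      (w = u \<and> q = p \<or>
       (\<exists>a v s. w = u @ a # v \<and> (p, a, s) \<in> trans A \<and> path_within A (S - {p}) s v q))"
    then obtain u where "path_within A S s u p" and
      u: "w = u \<and> q = p \<or>
       (\<exists>a v s. w = u @ a # v \<and> (p, a, s) \<in> trans A \<and> path_within A (S - {p}) s v q)" by blast
    then have "path_within A S t (a # u) p" using s by auto
    moreover have "a # w = a # u \<and> q = p \<or>
       (\<exists>b v s. a # w = (a # u) @ b # v \<and> (p, b, s) \<in> trans A \<and> path_within A (S - {p}) s v q)"
      using u by auto
    ultimately show ?thesis by blast
  qed
qed

section \<open>Simple paths and depth\<close>

lemma simple_path_Cons:
  assumes "simple_path A qs" "p \<in> states A" "p \<notin> set qs" "(p, a, hd qs) \<in> trans A"
  shows "simple_path A (p # qs)"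
  unfolding simple_path_def
proof (intro conjI allI impI)
  fix i assume "Suc i < length (p # qs)"
  then show "\<exists>a. ((p # qs) ! i, a, (p # qs) ! Suc i) \<in> trans A"
    using assms by (cases i) (auto simp: simple_path_def hd_conv_nth)
qed (use assms in \<open>auto simp: simple_path_def\<close>)

text \<open>A simple path has at most \<open>card (states A)\<close> states, so the
  \<open>Max\<close> in \<open>depth\<close> ranges over a finite set.\<close>

lemma simple_path_length_le_depth:
  assumes "finite (states A)" "simple_path A qs"
  shows "length qs \<le> depth A"
proof -
  have "length xs \<le> card (states A)" if "simple_path A xs" for xs
  proof -
    have "card (set xs) \<le> card (states A)" "distinct xs"
      using that assms(1) by (auto simp: simple_path_def intro: card_mono)
    then show ?thesis by (simp add: distinct_card)
  qed
  then have "{length qs | qs. simple_path A qs} \<subseteq> {..card (states A)}" by blast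
  then have "finite {length qs | qs. simple_path A qs}"
    using finite_subset by blast
  then show ?thesis
    unfolding depth_def using assms(2) by (intro Max_ge) auto
qed

section \<open>Cofinality of path languages\<close>

lemma cofinal_in_empty: "p \<in> states A \<Longrightarrow> cofinal_in (path_words A p p) []"
  by (simp add: cofinal_in_def)

lemma cofinal_in_letter:
  "path_within A (states A) p [a] q \<Longrightarrow> cofinal_in (path_words A p q) [Letter a]"
  by (simp add: cofinal_in_def)

lemma cofinal_in_path_append:
  assumes "cofinal_in (path_words A p s) P" "cofinal_in (path_words A s q) Q"
  shows "cofinal_in (path_words A p q) (P @ Q)"
  by (rule cofinal_in_mono[OF cofinal_in_append[OF assms]]) (auto simp: path_within_append)

text \<open>Each letter of \<open>u\<close> is found in a copy of \<open>c\<close> of its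
  own.\<close>

lemma subseq_concat_replicate:
  "set u \<subseteq> set c \<Longrightarrow> subseq u (concat (replicate (length u) c))"
proof (induction u)
  case Nil
  then show ?case by simp
next
  case (Cons a u)
  then have "subseq [a] c" by (simp add: subseq_singleton_left)
  with Cons show ?case
    using list_emb_append_mono[of "(=)" "[a]" c u] by simp
qed

text \<open>Going round the cycle \<open>c\<close> once for each letter of \<open>u\<close> gives a
  word above \<open>u\<close>; \<open>x\<close> and \<open>y\<close> do not leave the block, since
  their letters occur in \<open>c\<close>.\<close>

lemma cofinal_in_block:
  assumes "path_within A (states A) p x s" "path_within A (states A) s c s"
    "path_within A (states A) s y q" "set (x @ c @ y) \<subseteq> set c"
  shows "cofinal_in (path_words A p q) [Block (set c)]"
  unfolding cofinal_in_def
proof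
  fix u assume u: "u \<in> pattern_lang [Block (set c)]"
  let ?cs = "concat (replicate (length u) c)"
  have loop: "path_within A (states A) s (concat (replicate k c)) s" for k
    using assms(2) path_within_states[OF assms(2)]
    by (induction k) (auto simp: path_within_append)
  have "path_within A (states A) p (x @ ?cs @ y) q"
    using assms loop by (auto simp: path_within_append)
  moreover have "subseq u (x @ ?cs @ y)"
  proof -
    have "subseq u ?cs" using u by (intro subseq_concat_replicate) auto
    then show ?thesis by (simp add: list_emb_append2 subseq_rev_drop_many)
  qed
  moreover have "x @ ?cs @ y \<in> pattern_lang [Block (set c)]"
    using assms(4) by auto
  ultimately show "\<exists>u' \<in> pattern_lang [Block (set c)] \<inter> path_words A p q. subseq u u'"
    by blast
qed

section \<open>Cutting runs at last visits\<close>

text \<open>The part of the run up to the last visit of \<open>p\<close> becomes a block, the next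
  letter leaves \<open>p\<close> for good, and the rest lives in \<open>S - {p}\<close>. The states
  met in this way form the simple path \<open>qs\<close>, with one block for each state and one
  letter between neighbours. Every block misses a letter of \<open>G\<close>, which bounds its
  weight.\<close>

lemma cycle_decomposition:
  assumes "path_within A S p x q" "S \<subseteq> states A" "set x \<subseteq> G" "finite G"
    and "\<And>y c z s. x = y @ c @ z \<Longrightarrow> path_within A (states A) p y s \<Longrightarrow>
      path_within A (states A) s c s \<Longrightarrow> path_within A (states A) s z q \<Longrightarrow> set c \<noteq> G"
  shows "\<exists>P qs. x \<in> pattern_lang P \<and> (\<forall>b \<in> set P. finite_piece b) \<and>
    cofinal_in (path_words A p q) P \<and>
    simple_path A qs \<and> hd qs = p \<and> set qs \<subseteq> S \<and>
    weight n P < length qs * Suc (block_weight n (card G - 1))"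
  using assms(1,2,3,5)
proof (induction "length x" arbitrary: S p x rule: less_induct)
  case less
  let ?st = "states A"
  let ?k = "block_weight n (card G - 1)"
  have p: "p \<in> S" "p \<in> ?st"
    using path_within_states[OF less.prems(1)] less.prems(2) by auto
  \<comment> \<open>The path starts in \<open>p\<close>, so a last visit of \<open>p\<close>
    exists.\<close>
  have "\<not> path_within A (S - {p}) p x q"
    using path_within_states[of A "S - {p}" p x q] by blast
  with last_visit[OF less.prems(1), of p]
  obtain u where u: "path_within A S p u p" and
    split: "x = u \<and> q = p \<or> (\<exists>a v s. x = u @ a # v \<and> (p, a, s) \<in> trans A
      \<and> path_within A (S - {p}) s v q)"
    by blast
  have u_st: "path_within A ?st p u p" by (rule path_within_mono[OF u less.prems(2)])
  have p_st: "path_within A ?st p [] p" using p by simp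
  \<comment> \<open>The closed path \<open>u\<close> serves as its own cycle, with empty words
    before and after it.\<close>
  have cof_u: "cofinal_in (path_words A p p) [Block (set u)]"
    using cofinal_in_block[OF p_st u_st p_st] by simp
  have weight_u: "block_weight n (card (set u)) \<le> ?k" if "set u \<noteq> G"
  proof -
    have "set u \<subseteq> set x" using split by auto
    then have "set u \<subset> G" using that less.prems(3) by blast
    then have "card (set u) < card G" using assms(4) by (rule psubset_card_mono[rotated])
    then show ?thesis by (intro block_weight_mono) simp
  qed
  from split show ?case
  proof (elim disjE exE conjE)
    assume x: "x = u" "q = p"
    have "set u \<noteq> G" using less.prems(4)[of "[]" u "[]" p] u_st p_st x by simp
    then show ?thesis
      using x cof_u weight_u p
      by (intro exI[of _ "[Block (set u)]"] exI[of _ "[p]"]) (auto simp: simple_path_def)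
  next
    fix a v s assume x: "x = u @ a # v" and a: "(p, a, s) \<in> trans A"
      and v: "path_within A (S - {p}) s v q"
    have v_st: "path_within A ?st s v q" by (rule path_within_mono[OF v]) (use less.prems(2) in blast)
    have s_st: "s \<in> ?st" using path_within_states[OF v_st] by simp
    have a_st: "path_within A ?st p [a] s" using a p s_st by simp
    have av_st: "path_within A ?st p (a # v) q" using a p v_st by auto
    have "set u \<noteq> G" using less.prems(4)[of "[]" u "a # v" p] u_st p_st av_st x by simp
    note weight_u = weight_u[OF this]
    have sub: "S - {p} \<subseteq> ?st" "set v \<subseteq> G" using less.prems(2,3) x by auto
    \<comment> \<open>A cycle inside \<open>v\<close> is also a cycle inside \<open>x\<close>, so
      the assumption on cycles passes to the rest of the run.\<close>
    have no_cycle: "set c \<noteq> G" if "v = y @ c @ z" "path_within A ?st s y t"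
      "path_within A ?st t c t" "path_within A ?st t z q" for y c z t
    proof -
      have "path_within A ?st p (u @ a # y) t"
        using u_st a p that(2) by (auto simp: path_within_append)
      then show ?thesis using less.prems(4)[of "u @ a # y" c z t] that x by simp
    qed
    have "\<exists>P qs. v \<in> pattern_lang P \<and> (\<forall>b \<in> set P. finite_piece b) \<and>
        cofinal_in (path_words A s q) P \<and>
        simple_path A qs \<and> hd qs = s \<and> set qs \<subseteq> S - {p} \<and> weight n P < length qs * Suc ?k"
      by (rule less.hyps[OF _ v sub no_cycle]) (simp_all add: x)
    then obtain P qs where P: "v \<in> pattern_lang P" "\<forall>b \<in> set P. finite_piece b"
        "cofinal_in (path_words A s q) P"
      and qs: "simple_path A qs" "hd qs = s" "set qs \<subseteq> S - {p}"
      and weight_P: "weight n P < length qs * Suc ?k"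
      by blast
    let ?P = "[Block (set u)] @ [Letter a] @ P"
    have "u @ [a] @ v \<in> pattern_lang ?P"
      by (intro pattern_lang_appendI) (use P in auto)
    moreover have "cofinal_in (path_words A p q) ?P"
      by (intro cofinal_in_path_append[OF cof_u] cofinal_in_path_append[OF _ P(3)]
          cofinal_in_letter a_st)
    moreover have "simple_path A (p # qs)"
      by (rule simple_path_Cons[OF qs(1)]) (use qs p a in auto)
    moreover have "weight n ?P < length (p # qs) * Suc ?k"
      using weight_P weight_u by simp
    moreover have "\<forall>b \<in> set ?P. finite_piece b" "set (p # qs) \<subseteq> S"
      using P(2) qs(3) p(1) by auto
    ultimately show ?thesis
      unfolding x by (intro exI[of _ ?P] exI[of _ "p # qs"]) (simp del: weight_simps)
  qed
qed

section \<open>Refining a pattern along a subsequence\<close>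

text \<open>A letter is kept or deleted. A block is kept if \<open>x\<close> can be read through a
  cycle labelled by all of \<open>G\<close>; otherwise \<open>cycle_decomposition\<close> applies,
  and the depth bounds its simple path by \<open>n\<close> states.\<close>

lemma refine_piece:
  assumes fin: "finite (states A)" and depth: "depth A \<le> n"
    and path: "path_within A (states A) p x q"
    and x: "subseq x z" "z \<in> piece_lang b" and b: "finite_piece b"
  shows "\<exists>P. x \<in> pattern_lang P \<and> (\<forall>b' \<in> set P. finite_piece b') \<and>
    cofinal_in (path_words A p q) P \<and> (P = [b] \<or> weight n P < weight n [b])"
proof (cases b)
  case (Letter a)
  then have "x = [] \<or> x = [a]" using x by (cases x) (auto split: if_splits)
  then show ?thesis
  proof
    assume "x = []"
    then show ?thesis
      using path Letter cofinal_in_empty by (intro exI[of _ "[]"]) auto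
  next
    assume "x = [a]"
    then show ?thesis
      using cofinal_in_letter[of A p a q] path Letter by (intro exI[of _ "[b]"]) simp
  qed
next
  case (Block G)
  have xG: "set x \<subseteq> G" using x Block by (auto dest: list_emb_set)
  have G: "finite G" using b Block by simp
  show ?thesis
  proof (cases "\<exists>y c z s. x = y @ c @ z \<and> path_within A (states A) p y s \<and>
      path_within A (states A) s c s \<and> path_within A (states A) s z q \<and> set c = G")
    case True
    then obtain y c z s where c: "x = y @ c @ z" "path_within A (states A) p y s"
      "path_within A (states A) s c s" "path_within A (states A) s z q" "set c = G" by blast
    then have "cofinal_in (path_words A p q) [b]"
      using cofinal_in_block[of A p y s c z q] xG Block by auto
    then show ?thesis using xG b Block by (intro exI[of _ "[b]"]) auto
  next
    case False
    \<comment> \<open>For empty \<open>G\<close> the empty cycle at \<open>p\<close> would fall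
      under the first case. Hence \<open>card G - 1\<close> is a true predecessor and the recursion
      of \<open>block_weight\<close> applies.\<close>
    have "G \<noteq> {}"
    proof
      assume "G = {}"
      then have "x = [] \<and> p = q \<and> p \<in> states A" using xG path by auto
      then have "x = [] @ [] @ [] \<and> path_within A (states A) p [] p \<and>
          path_within A (states A) p [] q \<and> set [] = G" using \<open>G = {}\<close> by auto
      then show False using False by blast
    qed
    then obtain j where j: "card G = Suc j" using G by (cases "card G") auto
    then have G_weight: "block_weight n (card G) = n * Suc (block_weight n (card G - 1))"
      by (simp add: block_weight_Suc)
    have no_cycle: "set c \<noteq> G" if "x = y @ c @ z" "path_within A (states A) p y s"
      "path_within A (states A) s c s" "path_within A (states A) s z q" for y c z s
      using False that by blast
    have "\<exists>P qs. x \<in> pattern_lang P \<and> (\<forall>b \<in> set P. finite_piece b) \<and>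
        cofinal_in (path_words A p q) P \<and>
        simple_path A qs \<and> hd qs = p \<and> set qs \<subseteq> states A \<and>
        weight n P < length qs * Suc (block_weight n (card G - 1))"
      by (rule cycle_decomposition[OF path subset_refl xG G no_cycle])
    then obtain P qs where P: "x \<in> pattern_lang P" "\<forall>b \<in> set P. finite_piece b"
        "cofinal_in (path_words A p q) P" "simple_path A qs"
        "weight n P < length qs * Suc (block_weight n (card G - 1))"
      by blast
    have "length qs \<le> n"
      using simple_path_length_le_depth[OF fin P(4)] depth by simp
    then have "length qs * Suc (block_weight n (card G - 1)) \<le> block_weight n (card G)"
      unfolding G_weight by (rule mult_le_mono1)
    then have "weight n P < weight n [b]"
      using P(5) Block by simp
    then show ?thesis using P by blast
  qed
qed

text \<open>The word \<open>x\<close> splits along the pieces of \<open>P\<close>, and its path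
  splits at the corresponding states. Each piece is kept or replaced by something lighter, hence so
  is the whole pattern.\<close>

lemma refine_pattern:
  assumes fin: "finite (states A)" and depth: "depth A \<le> n"
    and "path_within A (states A) p x q" "subseq x z" "z \<in> pattern_lang P"
    and "\<forall>b \<in> set P. finite_piece b"
  shows "\<exists>P'. x \<in> pattern_lang P' \<and> (\<forall>b \<in> set P'. finite_piece b) \<and>
    cofinal_in (path_words A p q) P' \<and> (P' = P \<or> weight n P' < weight n P)"
  using assms(3-)
proof (induction P arbitrary: p x z)
  case Nil
  then have "x = []" by simp
  moreover from this have "p = q" "p \<in> states A" using Nil.prems by auto
  ultimately show ?case using cofinal_in_empty by (intro exI[of _ "[]"]) auto
next
  case (Cons b P)
  obtain z1 z2 where z: "z = z1 @ z2" "z1 \<in> piece_lang b" "z2 \<in> pattern_lang P"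
    using Cons.prems by auto
  obtain x1 x2 where x: "x = x1 @ x2" "subseq x1 z1" "subseq x2 z2"
    using Cons.prems z by (metis subseq_appendE)
  obtain s where s: "path_within A (states A) p x1 s" "path_within A (states A) s x2 q"
    using Cons.prems x by (auto simp: path_within_append)
  obtain P1 where P1: "x1 \<in> pattern_lang P1" "\<forall>b \<in> set P1. finite_piece b"
      "cofinal_in (path_words A p s) P1" "P1 = [b] \<or> weight n P1 < weight n [b]"
    using refine_piece[OF fin depth s(1) x(2) z(2)] Cons.prems by auto
  obtain P2 where P2: "x2 \<in> pattern_lang P2" "\<forall>b \<in> set P2. finite_piece b"
      "cofinal_in (path_words A s q) P2" "P2 = P \<or> weight n P2 < weight n P"
    using Cons.IH[OF s(2) x(3) z(3)] Cons.prems by auto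
  have "P1 @ P2 = b # P \<or> weight n (P1 @ P2) < weight n (b # P)"
    using P1(4) P2(4) by auto
  moreover have "x \<in> pattern_lang (P1 @ P2)"
    using x P1 P2 pattern_lang_appendI by blast
  ultimately show ?case
    using P1 P2 cofinal_in_path_append[OF P1(3) P2(3)] by (intro exI[of _ "P1 @ P2"]) auto
qed

lemma refine_pattern_lang:
  assumes "nfa_over Sig A" "depth A \<le> n" "x \<in> lang A" "subseq x z" "z \<in> pattern_lang P"
    "\<forall>b \<in> set P. finite_piece b"
  shows "\<exists>P'. x \<in> pattern_lang P' \<and> (\<forall>b \<in> set P'. finite_piece b) \<and>
    cofinal_in (lang A) P' \<and> (P' = P \<or> weight n P' < weight n P)"
proof -
  obtain p q where pq: "p \<in> init A" "q \<in> final A" "path_within A (states A) p x q"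
    using assms(3) by (auto simp: lang_eq_path_words)
  have "path_words A p q \<subseteq> lang A" using pq by (auto simp: lang_eq_path_words)
  moreover have "finite (states A)" using assms(1) by (simp add: nfa_over_def)
  ultimately show ?thesis
    using refine_pattern[OF _ assms(2) pq(3) assms(4-)] cofinal_in_mono by blast
qed

section \<open>Descent along the tower\<close>

theorem theorem7:
  fixes Sig :: "'a set" and A0 :: "('p, 'a) nfa" and A1 :: "('q, 'a) nfa"
    and m n r :: nat and w :: "nat \<Rightarrow> 'a list"
  assumes "finite Sig" and "card Sig = m"
    and "nfa_over Sig A0" and "nfa_over Sig A1"
    and "no_useless_states A0" and "no_useless_states A1"
    and "n \<ge> 2" and "depth A0 \<le> n" and "depth A1 \<le> n"
    and "\<not> (\<exists>v. infinite_tower (lang A0) (lang A1) v)"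
    and "tower (lang A0) (lang A1) w r"
    and "\<forall>i. 1 \<le> i \<and> i \<le> r \<longrightarrow> w i \<in> (if i mod 2 = 0 then lang A0 else lang A1)"
  shows "real r \<le> (real n ^ (m + 1) - 1) / (real n - 1)"
proof -
  \<comment> \<open>The automata have different state types, so the alternation is expressed by
    their languages.\<close>
  define M where "M i = (if i mod 2 = 0 then lang A0 else lang A1)" for i :: nat
  have w_M: "w i \<in> M i" if "1 \<le> i" "i \<le> r" for i
    using assms(12) that by (simp add: M_def)
  have r: "1 \<le> r" using assms(11) by (simp add: tower_def)
  have refine: "\<exists>P'. w i \<in> pattern_lang P' \<and> (\<forall>b \<in> set P'. finite_piece b) \<and>
      cofinal_in (M i) P' \<and> (P' = P \<or> weight n P' < weight n P)"
    if "1 \<le> i" "i \<le> r" "subseq (w i) z" "z \<in> pattern_lang P" "\<forall>b \<in> set P. finite_piece b"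
    for i z P
    using refine_pattern_lang[OF assms(3,8) _ that(3-)]
      refine_pattern_lang[OF assms(4,9) _ that(3-)] w_M[OF that(1,2)]
    by (auto simp: M_def split: if_splits)
  \<comment> \<open>Here \<open>d\<close> counts the steps down from \<open>w r\<close>; each one is
    paid for by a unit of weight.\<close>
  have "\<exists>P. w (r - d) \<in> pattern_lang P \<and> (\<forall>b \<in> set P. finite_piece b) \<and>
      cofinal_in (M (r - d)) P \<and> weight n P + d \<le> block_weight n m" if "d < r" for d
    using that
  proof (induction d)
    case 0
    \<comment> \<open>The descent starts from \<open>[Block Sig]\<close>, which has weight
      \<open>block_weight n m\<close>.\<close>
    have "w r \<in> lists Sig"
      using w_M[OF r] lang_subset_lists[OF assms(3)] lang_subset_lists[OF assms(4)]
      by (auto simp: M_def split: if_splits)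
    then have "\<exists>P. w r \<in> pattern_lang P \<and> (\<forall>b \<in> set P. finite_piece b) \<and>
      cofinal_in (M r) P \<and> (P = [Block Sig] \<or> weight n P < weight n [Block Sig])"
      using refine[OF r, of "w r" "[Block Sig]"] assms(1) by simp
    then show ?case using assms(2) by force
  next
    case (Suc d)
    define i where "i = r - Suc d"
    have i: "1 \<le> i" "i < r" "r - d = Suc i" using Suc.prems by (auto simp: i_def)
    obtain P where P: "w (Suc i) \<in> pattern_lang P" "\<forall>b \<in> set P. finite_piece b"
      "cofinal_in (M (Suc i)) P" "weight n P + d \<le> block_weight n m"
      using Suc.IH Suc.prems i(3) by auto
    have "subseq (w i) (w (Suc i))" using assms(11) i by (auto simp: tower_def)
    then obtain P' where P': "w i \<in> pattern_lang P'" "\<forall>b \<in> set P'. finite_piece b"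
      "cofinal_in (M i) P'" "P' = P \<or> weight n P' < weight n P"
      using refine[of i "w (Suc i)" P] P i by auto
    \<comment> \<open>As \<open>i\<close> and \<open>Suc i\<close> differ in parity, both languages
      would be cofinal in an unchanged pattern, giving an infinite tower.\<close>
    have "P' \<noteq> P"
    proof
      assume "P' = P"
      then have "cofinal_in (lang A0) P" "cofinal_in (lang A1) P"
        using P(3) P'(3) by (auto simp: M_def mod_Suc split: if_splits)
      then show False using infinite_tower_if_both_cofinal[OF P(1)] assms(10) by blast
    qed
    then have "weight n P' + Suc d \<le> block_weight n m" using P(4) P'(4) by simp
    then show ?case using P' unfolding i_def by blast
  qed
  \<comment> \<open>At \<open>d = r - 1\<close> the descent has reached \<open>w 1\<close>, with
    nonnegative weight left.\<close>
  from this[of "r - 1"] r have "r \<le> block_weight n m + 1" by auto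
  \<comment> \<open>The additional 1 is the summand with exponent 0 and completes the geometric
    sum.\<close>
  also have "block_weight n m + 1 = (\<Sum>i\<le>m. n ^ i)"
    by (simp add: block_weight_def atMost_atLeast0 sum.atLeast_Suc_atMost)
  finally have "real r \<le> (\<Sum>i\<le>m. real n ^ i)"
    by (metis of_nat_le_iff of_nat_power of_nat_sum sum.cong)
  also have "\<dots> = (real n ^ (m + 1) - 1) / (real n - 1)"
    using assms(7) geometric_sum[of "real n" "Suc m"] by (simp add: lessThan_Suc_atMost)
  finally show ?thesis .
qed

end
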